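(* Let $f\in\mathbb{C}[x_1,\ldots,x_n]$ be a diagonalizable homogeneous polynomial of degree $d\ge 3$, and let $P\in\mathbb{C}^{n\times n}$ be the computed matrix of a change of variables $z=Px$ for which $f(P^{-1}z)$ is diagonal. Then determining the orthogonality and unitarity of the diagonalization of $f$ from $P$ takes $O(n^3)$ arithmetic operations.
   Context: Complexity is counted in arithmetic operations over $\mathbb{C}$ (complex conjugation of an entry counting as one operation). A homogeneous polynomial $f\in\mathbb{C}[x_1,\ldots,x_n]$ of degree $d$ is diagonalizable if after an invertible linear change of variables it can be written as $c_1z_1^d+\cdots+c_nz_n^d$ with $c_i\in\mathbb{C}$; here this means $f(P^{-1}z)=c_1z_1^d+\cdots+c_nz_n^d$ with $P$ invertible. Orthogonality and unitarity are determined as follows: the diagonalization is declared orthogonal if $PP^T$ is a diagonal matrix, and unitary if $P\overline{P}^{\,T}$ is a diagonal matrix, where $\overline{P}$ denotes the entrywise complex conjugate. *)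

theory Defs
  imports "HOL-Library.Poly_Mapping" "HOL-Library.Landau_Symbols" "Jordan_Normal_Form.Matrix"
begin

section \<open>Diagonalizable homogeneous polynomials\<close>

text \<open>
  A polynomial maps each exponent vector to its coefficient. The variables are numbered
  from 0, so \<open>x\<^sub>1, \<dots>, x\<^sub>n\<close> are the variables with index below \<open>n\<close>.
\<close>

type_synonym cpoly = "(nat \<Rightarrow>\<^sub>0 nat) \<Rightarrow>\<^sub>0 complex"

definition pconst :: "complex \<Rightarrow> cpoly" where
  "pconst c = Poly_Mapping.single 0 c"

definition pvar :: "nat \<Rightarrow> cpoly" where
  "pvar i = Poly_Mapping.single (Poly_Mapping.single i 1) 1"

definition homogeneous_poly :: "nat \<Rightarrow> nat \<Rightarrow> cpoly \<Rightarrow> bool" where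
  "homogeneous_poly n d f \<longleftrightarrow>
     (\<forall>m \<in> Poly_Mapping.keys f.
        Poly_Mapping.keys m \<subseteq> {..<n} \<and>
        (\<Sum>i \<in> Poly_Mapping.keys m. Poly_Mapping.lookup m i) = d)"

definition psubst :: "(nat \<Rightarrow> cpoly) \<Rightarrow> cpoly \<Rightarrow> cpoly" where
  "psubst g f =
     (\<Sum>m \<in> Poly_Mapping.keys f.
        pconst (Poly_Mapping.lookup f m) *
        (\<Prod>i \<in> Poly_Mapping.keys m. g i ^ Poly_Mapping.lookup m i))"

text \<open>The polynomial \<open>f(Q z)\<close> in the variables \<open>z\<close>.\<close>

definition linear_change :: "nat \<Rightarrow> complex mat \<Rightarrow> cpoly \<Rightarrow> cpoly" where
  "linear_change n Q f = psubst (\<lambda>i. \<Sum>j<n. pconst (Q $$ (i, j)) * pvar j) f"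

text \<open>In the following definition \<open>Q\<close> is the inverse of \<open>P\<close>.\<close>

definition diagonalizes :: "nat \<Rightarrow> nat \<Rightarrow> complex mat \<Rightarrow> cpoly \<Rightarrow> bool" where
  "diagonalizes n d P f \<longleftrightarrow>
     P \<in> carrier_mat n n \<and>
     (\<exists>Q \<in> carrier_mat n n. inverts_mat P Q \<and> inverts_mat Q P \<and>
        (\<exists>c. linear_change n Q f = (\<Sum>i<n. pconst (c i) * pvar i ^ d)))"

definition diagonalizable_poly :: "nat \<Rightarrow> nat \<Rightarrow> cpoly \<Rightarrow> bool" where
  "diagonalizable_poly n d f \<longleftrightarrow> (\<exists>P. diagonalizes n d P f)"

definition orthogonal_diagonalization :: "complex mat \<Rightarrow> bool" where
  "orthogonal_diagonalization P \<longleftrightarrow> diagonal_mat (P * transpose_mat P)"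

definition unitary_diagonalization :: "complex mat \<Rightarrow> bool" where
  "unitary_diagonalization P \<longleftrightarrow> diagonal_mat (P * transpose_mat (map_mat cnj P))"


section \<open>Programs over the complex numbers\<close>

text \<open>
  A random access machine in the style of Blum, Shub and Smale, programmed in a while language.
  A state consists of index registers, which hold natural numbers and serve for control and
  addressing, and of memory cells, which hold exact complex numbers. A program is a finite
  object and does not depend on the size of its input. The contents of a memory cell can
  influence the control flow only through \<open>IfZero\<close>.
\<close>

type_synonym state = "(nat \<Rightarrow> nat) \<times> (nat \<Rightarrow> complex)"

datatype iexp = Num nat | Reg nat | Plus iexp iexp | Minus iexp iexp | Times iexp iexp

primrec ival :: "(nat \<Rightarrow> nat) \<Rightarrow> iexp \<Rightarrow> nat" where
  "ival r (Num k) = k"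
| "ival r (Reg x) = r x"
| "ival r (Plus a b) = ival r a + ival r b"
| "ival r (Minus a b) = ival r a - ival r b"
| "ival r (Times a b) = ival r a * ival r b"

text \<open>
  In the commands that access the memory, an index expression denotes the memory cell whose
  address is its value. The first argument is the target, except for \<open>IfZero\<close>.
\<close>

datatype com =
    Skip
  | SetReg nat iexp
  | Const iexp complex
  | Copy iexp iexp
  | Add iexp iexp iexp
  | Sub iexp iexp iexp
  | Mul iexp iexp iexp
  | Div iexp iexp iexp
  | Conj iexp iexp
  | Seq com com
  | IfLess iexp iexp com com
  | IfZero iexp com com
  | While iexp iexp com

text \<open>
  \<open>exec p s k t\<close>: started in state \<open>s\<close>, the program \<open>p\<close> halts in state \<open>t\<close> after \<open>k\<close> arithmetic
  operations over the complex numbers. Each of the four field operations, each conjugation and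
  each test of a complex number for zero counts as one operation; index computations, data
  movement and constants are free. A division by zero has no result, so that the program does
  not halt. \<open>While a b p\<close> repeats \<open>p\<close> as long as \<open>a < b\<close>.
\<close>

inductive exec :: "com \<Rightarrow> state \<Rightarrow> nat \<Rightarrow> state \<Rightarrow> bool" where
  Skip: "exec Skip s 0 s"
| SetReg: "exec (SetReg x a) (r, m) 0 (r(x := ival r a), m)"
| Const: "exec (Const a z) (r, m) 0 (r, m(ival r a := z))"
| Copy: "exec (Copy a b) (r, m) 0 (r, m(ival r a := m (ival r b)))"
| Add: "exec (Add a b c) (r, m) 1 (r, m(ival r a := m (ival r b) + m (ival r c)))"
| Sub: "exec (Sub a b c) (r, m) 1 (r, m(ival r a := m (ival r b) - m (ival r c)))"
| Mul: "exec (Mul a b c) (r, m) 1 (r, m(ival r a := m (ival r b) * m (ival r c)))"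
| Div: "m (ival r c) \<noteq> 0 \<Longrightarrow>
    exec (Div a b c) (r, m) 1 (r, m(ival r a := m (ival r b) / m (ival r c)))"
| Conj: "exec (Conj a b) (r, m) 1 (r, m(ival r a := cnj (m (ival r b))))"
| Seq: "exec p s k s' \<Longrightarrow> exec q s' l t \<Longrightarrow> exec (Seq p q) s (k + l) t"
| IfLessTrue: "ival r a < ival r b \<Longrightarrow> exec p (r, m) k t \<Longrightarrow> exec (IfLess a b p q) (r, m) k t"
| IfLessFalse: "\<not> ival r a < ival r b \<Longrightarrow> exec q (r, m) k t \<Longrightarrow> exec (IfLess a b p q) (r, m) k t"
| IfZeroTrue: "m (ival r a) = 0 \<Longrightarrow> exec p (r, m) k t \<Longrightarrow> exec (IfZero a p q) (r, m) (k + 1) t"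
| IfZeroFalse: "m (ival r a) \<noteq> 0 \<Longrightarrow> exec q (r, m) k t \<Longrightarrow> exec (IfZero a p q) (r, m) (k + 1) t"
| WhileFalse: "\<not> ival r a < ival r b \<Longrightarrow> exec (While a b p) (r, m) 0 (r, m)"
| WhileTrue: "ival r a < ival r b \<Longrightarrow> exec p (r, m) k s' \<Longrightarrow> exec (While a b p) s' l t \<Longrightarrow>
    exec (While a b p) (r, m) (k + l) t"

inductive_cases exec_elims:
  "exec Skip s k t"
  "exec (SetReg x a) s k t"
  "exec (Const a z) s k t"
  "exec (Copy a b) s k t"
  "exec (Add a b c) s k t"
  "exec (Sub a b c) s k t"
  "exec (Mul a b c) s k t"
  "exec (Div a b c) s k t"
  "exec (Conj a b) s k t"
  "exec (Seq p q) s k t"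
  "exec (IfLess a b p q) s k t"
  "exec (IfZero a p q) s k t"
  "exec (While a b p) s k t"

lemma exec_deterministic:
  "exec p s k t \<Longrightarrow> exec p s k' t' \<Longrightarrow> k' = k \<and> t' = t"
proof (induction arbitrary: k' t' rule: exec.induct)
  case (Seq p s k s' q l t)
  from Seq.prems obtain s2 k2 l2 where "exec p s k2 s2" "exec q s2 l2 t'" "k' = k2 + l2"
    by (rule exec_elims)
  with Seq.IH(1)[of k2 s2] Seq.IH(2)[of l2 t'] show ?case by simp
next
  case (IfLessTrue r a b p m k t q)
  from IfLessTrue.prems IfLessTrue.hyps(1) have "exec p (r, m) k' t'"
    by (auto elim: exec_elims(11))
  with IfLessTrue.IH show ?case by simp
next
  case (IfLessFalse r a b q m k t p)
  from IfLessFalse.prems IfLessFalse.hyps(1) have "exec q (r, m) k' t'"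
    by (auto elim: exec_elims(11))
  with IfLessFalse.IH show ?case by simp
next
  case (IfZeroTrue m r a p k t q)
  from IfZeroTrue.prems IfZeroTrue.hyps(1) obtain k2 where "exec p (r, m) k2 t'" "k' = k2 + 1"
    by (auto elim: exec_elims(12))
  with IfZeroTrue.IH[of k2 t'] show ?case by simp
next
  case (IfZeroFalse m r a q k t p)
  from IfZeroFalse.prems IfZeroFalse.hyps(1) obtain k2 where "exec q (r, m) k2 t'" "k' = k2 + 1"
    by (auto elim: exec_elims(12))
  with IfZeroFalse.IH[of k2 t'] show ?case by simp
next
  case (WhileFalse r a b p m)
  from WhileFalse.prems show ?case
    by (rule exec_elims(13)) (use WhileFalse.hyps in simp_all)
next
  case (WhileTrue r a b p m k s' l t)
  from WhileTrue.prems show ?case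
  proof (rule exec_elims(13), goal_cases)
    case 1
    with WhileTrue.hyps(1) show ?case by simp
  next
    case (2 r2 m2 k2 s2 l2)
    then have "exec p (r, m) k2 s2" "exec (While a b p) s2 l2 t'" "k' = k2 + l2" by simp_all
    with WhileTrue.IH(1)[of k2 s2] WhileTrue.IH(2)[of l2 t'] show ?case by simp
  qed
qed (erule exec_elims, simp)+

text \<open>
  Initially register 0 contains \<open>n\<close>, the first \<open>n\<^sup>2\<close> memory cells contain the matrix row by row,
  and everything else is 0.
\<close>

definition input_state :: "nat \<Rightarrow> complex mat \<Rightarrow> state" where
  "input_state n P =
     ((\<lambda>x. if x = 0 then n else 0),
      (\<lambda>a. if a < n * n then P $$ (a div n, a mod n) else 0))"

text \<open>The two answers are returned in the registers 0 and 1, with 1 for yes and 0 for no.\<close>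

definition outputs :: "state \<Rightarrow> bool \<Rightarrow> bool \<Rightarrow> bool" where
  "outputs s b b' \<longleftrightarrow> fst s 0 = of_bool b \<and> fst s 1 = of_bool b'"

end

theory Submission
  imports Defs
begin

text \<open>
  The diagonalization is orthogonal iff any two distinct rows \<open>p\<^sub>i\<close>, \<open>p\<^sub>j\<close> of \<open>P\<close> satisfy
  \<open>p\<^sub>i p\<^sub>j\<^sup>T = 0\<close>, and unitary iff they satisfy \<open>p\<^sub>i (cnj p\<^sub>j)\<^sup>T = 0\<close>, because these numbers
  are the off-diagonal entries of \<open>P P\<^sup>T\<close> and \<open>P (cnj P)\<^sup>T\<close>. Interchanging \<open>i\<close> and \<open>j\<close> leaves
  the first number unchanged and conjugates the second, so the pairs with \<open>j < i\<close> decide both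
  questions (\<open>orthogonal_iff_row_pairs\<close>, \<open>unitary_iff_row_pairs\<close>).

  The program runs through these pairs. For each one it accumulates both products
  simultaneously, which takes five operations per column, and then tests them for zero. The at
  most \<open>n\<^sup>2\<close> pairs therefore cost at most \<open>n\<^sup>2 (5 n + 2) = O(n\<^sup>3)\<close> operations. Correctness and
  cost are proved together, loop by loop, by means of the invariant rule \<open>achieves_While\<close>.
\<close>

section \<open>Correctness and cost of programs\<close>

definition achieves :: "com \<Rightarrow> nat \<Rightarrow> (state \<Rightarrow> bool) \<Rightarrow> state \<Rightarrow> bool" where
  "achieves p c Q s \<longleftrightarrow> (\<exists>k t. exec p s k t \<and> k \<le> c \<and> Q t)"

lemma achieves_weaken:
  "achieves p c Q s \<Longrightarrow> c \<le> c' \<Longrightarrow> (\<And>t. Q t \<Longrightarrow> Q' t) \<Longrightarrow> achieves p c' Q' s"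
  unfolding achieves_def by (meson le_trans)

lemma achieves_Seq:
  assumes "achieves p c R s" and "\<And>t. R t \<Longrightarrow> achieves q d Q t"
  shows "achieves (Seq p q) (c + d) Q s"
  using assms unfolding achieves_def by (meson add_mono exec.Seq)

lemma achieves_SetReg: "achieves (SetReg x a) c Q (r, m) \<longleftrightarrow> Q (r(x := ival r a), m)"
  unfolding achieves_def by (fastforce elim: exec_elims intro: exec.intros)

text \<open>
  As rewrite rules, these equations let the simplifier execute straight-line code symbolically.
  An operation that is charged consumes one successor of the cost bound.
\<close>

lemma achieves_Seq_basic:
  "achieves (Seq (SetReg x a) q) c Q (r, m) \<longleftrightarrow> achieves q c Q (r(x := ival r a), m)"
  "achieves (Seq (Const a z) q) c Q (r, m) \<longleftrightarrow> achieves q c Q (r, m(ival r a := z))"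
  "achieves (Seq (Add a b b') q) (Suc c) Q (r, m) \<longleftrightarrow>
     achieves q c Q (r, m(ival r a := m (ival r b) + m (ival r b')))"
  "achieves (Seq (Mul a b b') q) (Suc c) Q (r, m) \<longleftrightarrow>
     achieves q c Q (r, m(ival r a := m (ival r b) * m (ival r b')))"
  "achieves (Seq (Conj a b) q) (Suc c) Q (r, m) \<longleftrightarrow>
     achieves q c Q (r, m(ival r a := cnj (m (ival r b))))"
  "achieves (Seq (IfZero a Skip (SetReg x b)) q) (Suc c) Q (r, m) \<longleftrightarrow>
     achieves q c Q (if m (ival r a) = 0 then r else r(x := ival r b), m)"
proof -
  have zero: "achieves (Seq p q) c Q s \<longleftrightarrow> achieves q c Q t"
    if "\<And>k t'. exec p s k t' \<longleftrightarrow> k = 0 \<and> t' = t" for p s t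
    unfolding achieves_def using that
    by (metis exec_elims(10) exec.Seq add_0)
  have one: "achieves (Seq p q) (Suc c) Q s \<longleftrightarrow> achieves q c Q t"
    if "\<And>k t'. exec p s k t' \<longleftrightarrow> k = 1 \<and> t' = t" for p s t
    unfolding achieves_def using that
    by (metis exec_elims(10) exec.Seq plus_1_eq_Suc Suc_le_mono)
  show "achieves (Seq (SetReg x a) q) c Q (r, m) \<longleftrightarrow> achieves q c Q (r(x := ival r a), m)"
    by (rule zero) (auto elim: exec_elims intro: exec.intros)
  show "achieves (Seq (Const a z) q) c Q (r, m) \<longleftrightarrow> achieves q c Q (r, m(ival r a := z))"
    by (rule zero) (auto elim: exec_elims intro: exec.intros)
  show "achieves (Seq (Add a b b') q) (Suc c) Q (r, m) \<longleftrightarrow>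
     achieves q c Q (r, m(ival r a := m (ival r b) + m (ival r b')))"
    by (rule one) (auto elim: exec_elims intro: exec.intros[unfolded One_nat_def])
  show "achieves (Seq (Mul a b b') q) (Suc c) Q (r, m) \<longleftrightarrow>
     achieves q c Q (r, m(ival r a := m (ival r b) * m (ival r b')))"
    by (rule one) (auto elim: exec_elims intro: exec.intros[unfolded One_nat_def])
  show "achieves (Seq (Conj a b) q) (Suc c) Q (r, m) \<longleftrightarrow>
     achieves q c Q (r, m(ival r a := cnj (m (ival r b))))"
    by (rule one) (auto elim: exec_elims intro: exec.intros[unfolded One_nat_def])
  show "achieves (Seq (IfZero a Skip (SetReg x b)) q) (Suc c) Q (r, m) \<longleftrightarrow>
     achieves q c Q (if m (ival r a) = 0 then r else r(x := ival r b), m)"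
    by (rule one) (auto elim!: exec_elims(1,2,12) intro: exec.intros
        intro: exec.IfZeroTrue[where k = 0, simplified] exec.IfZeroFalse[where k = 0, simplified])
qed

text \<open>
  The loop counter is an argument of the invariant \<open>I\<close>, which makes the loop terminate after
  exactly \<open>N\<close> rounds; the cost then follows from a bound on a single round.
\<close>

lemma achieves_While:
  assumes step: "\<And>i s. i < N \<Longrightarrow> I i s \<Longrightarrow> achieves p c (I (Suc i)) s"
    and guard: "\<And>i s. i \<le> N \<Longrightarrow> I i s \<Longrightarrow> ival (fst s) a < ival (fst s) b \<longleftrightarrow> i < N"
    and init: "I 0 s"
  shows "achieves (While a b p) (N * c) (I N) s"
proof -
  have "achieves (While a b p) ((N - i) * c) (I N) s" if "i \<le> N" "I i s" for i s
    using that
  proof (induction i arbitrary: s rule: inc_induct)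
    case base
    then show ?case
      using guard[of N s] by (cases s) (auto simp: achieves_def intro: exec.WhileFalse)
  next
    case (step i)
    from assms(1)[OF step.hyps(2) step.prems]
    obtain k s' where s': "exec p s k s'" "k \<le> c" "I (Suc i) s'"
      unfolding achieves_def by blast
    from step.IH[OF s'(3)]
    obtain l t where t: "exec (While a b p) s' l t" "l \<le> (N - Suc i) * c" "I N t"
      unfolding achieves_def by blast
    have "ival (fst s) a < ival (fst s) b"
      using guard[of i s] step.hyps step.prems by simp
    with s'(1) t(1) have "exec (While a b p) s (k + l) t"
      by (cases s) (auto intro: exec.WhileTrue)
    moreover have "k + l \<le> (N - i) * c"
    proof -
      have "N - i = Suc (N - Suc i)" using step.hyps by simp
      with s'(2) t(2) show ?thesis by simp
    qed
    ultimately show ?case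
      using t(3) unfolding achieves_def by blast
  qed
  from this[of 0 s] init show ?thesis by simp
qed

section \<open>Products of rows\<close>

text \<open>
  The sums extend over the first \<open>l\<close> columns only, so that they also describe the intermediate
  results of the accumulation.
\<close>

definition bilinear :: "complex mat \<Rightarrow> nat \<Rightarrow> nat \<Rightarrow> nat \<Rightarrow> complex" where
  "bilinear P l i j = (\<Sum>k<l. P $$ (i, k) * P $$ (j, k))"

definition sesquilinear :: "complex mat \<Rightarrow> nat \<Rightarrow> nat \<Rightarrow> nat \<Rightarrow> complex" where
  "sesquilinear P l i j = (\<Sum>k<l. P $$ (i, k) * cnj (P $$ (j, k)))"

lemma bilinear_commute: "bilinear P l i j = bilinear P l j i"
  by (simp add: bilinear_def mult.commute)

lemma sesquilinear_commute: "sesquilinear P l i j = cnj (sesquilinear P l j i)"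
  by (simp add: sesquilinear_def mult.commute)

lemma vanishes_off_diagonal_iff:
  fixes g :: "nat \<Rightarrow> nat \<Rightarrow> complex"
  assumes "\<And>i j. g i j = 0 \<longleftrightarrow> g j i = 0"
  shows "(\<forall>i<n. \<forall>j<n. i \<noteq> j \<longrightarrow> g i j = 0) \<longleftrightarrow> (\<forall>i<n. \<forall>j<i. g i j = 0)"
  using assms by (metis less_trans nat_neq_iff)

lemma orthogonal_iff_row_pairs:
  assumes "P \<in> carrier_mat n n"
  shows "orthogonal_diagonalization P \<longleftrightarrow> (\<forall>i<n. \<forall>j<i. bilinear P n i j = 0)"
proof -
  have "(P * transpose_mat P) $$ (i, j) = bilinear P n i j" if "i < n" "j < n" for i j
    using assms that by (simp add: bilinear_def scalar_prod_def atLeast0LessThan)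
  then have "orthogonal_diagonalization P \<longleftrightarrow>
      (\<forall>i<n. \<forall>j<n. i \<noteq> j \<longrightarrow> bilinear P n i j = 0)"
    using assms by (simp add: orthogonal_diagonalization_def diagonal_mat_def)
  also have "\<dots> \<longleftrightarrow> (\<forall>i<n. \<forall>j<i. bilinear P n i j = 0)"
    by (rule vanishes_off_diagonal_iff) (simp add: bilinear_commute)
  finally show ?thesis .
qed

lemma unitary_iff_row_pairs:
  assumes "P \<in> carrier_mat n n"
  shows "unitary_diagonalization P \<longleftrightarrow> (\<forall>i<n. \<forall>j<i. sesquilinear P n i j = 0)"
proof -
  have "(P * transpose_mat (map_mat cnj P)) $$ (i, j) = sesquilinear P n i j"
    if "i < n" "j < n" for i j
    using assms that by (simp add: sesquilinear_def scalar_prod_def atLeast0LessThan)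
  then have "unitary_diagonalization P \<longleftrightarrow>
      (\<forall>i<n. \<forall>j<n. i \<noteq> j \<longrightarrow> sesquilinear P n i j = 0)"
    using assms by (simp add: unitary_diagonalization_def diagonal_mat_def)
  also have "\<dots> \<longleftrightarrow> (\<forall>i<n. \<forall>j<i. sesquilinear P n i j = 0)"
    by (rule vanishes_off_diagonal_iff) (metis sesquilinear_commute complex_cnj_zero)
  finally show ?thesis .
qed

section \<open>The decision program\<close>

text \<open>
  Register 0 keeps \<open>n\<close> until the answers are stored. Registers 2 and 3 hold the current pair of
  rows, register 4 the column, and registers 5 and 6 the two answers for the pairs visited so
  far. The two sums and an intermediate result occupy the cells from \<open>n\<^sup>2\<close> on, just behind the
  matrix.
\<close>

abbreviation entry :: "nat \<Rightarrow> nat \<Rightarrow> iexp" where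
  "entry x y \<equiv> Plus (Times (Reg x) (Reg 0)) (Reg y)"

abbreviation workspace :: "nat \<Rightarrow> iexp" where
  "workspace k \<equiv> Plus (Times (Reg 0) (Reg 0)) (Num k)"

definition column_step :: com where
  "column_step =
     Seq (Mul (workspace 2) (entry 2 4) (entry 3 4))
    (Seq (Add (workspace 0) (workspace 0) (workspace 2))
    (Seq (Conj (workspace 2) (entry 3 4))
    (Seq (Mul (workspace 2) (entry 2 4) (workspace 2))
    (Seq (Add (workspace 1) (workspace 1) (workspace 2))
         (SetReg 4 (Plus (Reg 4) (Num 1)))))))"

definition pair_step :: com where
  "pair_step =
     Seq (SetReg 4 (Num 0))
    (Seq (Const (workspace 0) 0)
    (Seq (Const (workspace 1) 0)
    (Seq (While (Reg 4) (Reg 0) column_step)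
    (Seq (IfZero (workspace 0) Skip (SetReg 5 (Num 0)))
    (Seq (IfZero (workspace 1) Skip (SetReg 6 (Num 0)))
         (SetReg 3 (Plus (Reg 3) (Num 1))))))))"

definition row_step :: com where
  "row_step =
     Seq (SetReg 3 (Num 0))
    (Seq (While (Reg 3) (Reg 2) pair_step)
         (SetReg 2 (Plus (Reg 2) (Num 1))))"

definition decide_diagonalization :: com where
  "decide_diagonalization =
     Seq (SetReg 5 (Num 1))
    (Seq (SetReg 6 (Num 1))
    (Seq (SetReg 2 (Num 0))
    (Seq (While (Reg 2) (Reg 0) row_step)
    (Seq (SetReg 0 (Reg 5))
         (SetReg 1 (Reg 6))))))"

section \<open>Loop invariants\<close>

definition stores :: "nat \<Rightarrow> complex mat \<Rightarrow> state \<Rightarrow> bool" where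
  "stores n P s \<longleftrightarrow> fst s 0 = n \<and> (\<forall>i<n. \<forall>j<n. snd s (i * n + j) = P $$ (i, j))"

text \<open>
  The pairs that precede \<open>(i, j)\<close> in the order of the two loops. Those preceding \<open>(n, 0)\<close> are
  all pairs below the diagonal.
\<close>

definition visited :: "nat \<Rightarrow> nat \<Rightarrow> (nat \<times> nat) set" where
  "visited i j = {(a, b). b < a \<and> (a < i \<or> a = i \<and> b < j)}"

lemma visited_0: "visited 0 0 = {}"
  by (auto simp: visited_def)

lemma visited_Suc_pair: "j < i \<Longrightarrow> visited i (Suc j) = insert (i, j) (visited i j)"
  by (auto simp: visited_def)

lemma visited_Suc_row: "visited (Suc i) 0 = visited i i"
  by (auto simp: visited_def less_Suc_eq)

definition answers :: "nat \<Rightarrow> complex mat \<Rightarrow> (nat \<times> nat) set \<Rightarrow> state \<Rightarrow> bool" where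
  "answers n P S s \<longleftrightarrow>
     fst s 5 = of_bool (\<forall>(a, b) \<in> S. bilinear P n a b = 0) \<and>
     fst s 6 = of_bool (\<forall>(a, b) \<in> S. sesquilinear P n a b = 0)"

definition row_inv :: "nat \<Rightarrow> complex mat \<Rightarrow> nat \<Rightarrow> state \<Rightarrow> bool" where
  "row_inv n P i s \<longleftrightarrow> stores n P s \<and> fst s 2 = i \<and> answers n P (visited i 0) s"

definition pair_inv :: "nat \<Rightarrow> complex mat \<Rightarrow> nat \<Rightarrow> nat \<Rightarrow> state \<Rightarrow> bool" where
  "pair_inv n P i j s \<longleftrightarrow>
     stores n P s \<and> fst s 2 = i \<and> fst s 3 = j \<and> answers n P (visited i j) s"

definition column_inv :: "nat \<Rightarrow> complex mat \<Rightarrow> nat \<Rightarrow> nat \<Rightarrow> nat \<Rightarrow> state \<Rightarrow> bool" where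
  "column_inv n P i j l s \<longleftrightarrow>
     pair_inv n P i j s \<and> fst s 4 = l \<and>
     snd s (n * n) = bilinear P l i j \<and> snd s (n * n + 1) = sesquilinear P l i j"

lemma entry_address_less:
  fixes i j n :: nat
  assumes "i < n" "j < n"
  shows "i * n + j < n * n"
proof -
  have "i * n + j < Suc i * n" using assms(2) by simp
  also have "\<dots> \<le> n * n" using assms(1) by (intro mult_right_mono) simp_all
  finally show ?thesis .
qed

lemma entry_not_workspace:
  fixes i j n :: nat
  assumes "i < n" "j < n"
  shows "i * n + j \<noteq> n * n" "i * n + j \<noteq> Suc (n * n)" "i * n + j \<noteq> Suc (Suc (n * n))"
  using entry_address_less[OF assms] by simp_all

lemma stores_workspace_update:
  "stores n P (r, m) \<Longrightarrow> stores n P (r, m(n * n + k := z))"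
  by (auto simp: stores_def dest: entry_address_less)

lemma column_step_correct:
  assumes "i < n" "j < n" "l < n" and inv: "column_inv n P i j l s"
  shows "achieves column_step 5 (column_inv n P i j (Suc l)) s"
proof (cases s)
  case (Pair r m)
  have lt: "i * n + l < n * n" "j * n + l < n * n"
    using assms by (simp_all add: entry_address_less)
  have st: "r 0 = n" "r 2 = i" "r 3 = j" "r 4 = l"
    "m (i * n + l) = P $$ (i, l)" "m (j * n + l) = P $$ (j, l)"
    "m (n * n) = bilinear P l i j" "m (Suc (n * n)) = sesquilinear P l i j"
    using assms unfolding Pair column_inv_def pair_inv_def stores_def by auto
  have mat: "\<And>a b. a < n \<Longrightarrow> b < n \<Longrightarrow> m (a * n + b) = P $$ (a, b)"
    and ans: "answers n P (visited i j) (r, m)"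
    using inv unfolding Pair column_inv_def pair_inv_def stores_def by auto
  \<comment> \<open>the form in which the cost bound pays for the five operations one by one\<close>
  have five: "5 = Suc (Suc (Suc (Suc (Suc 0))))" by simp
  show ?thesis
    unfolding column_step_def Pair five achieves_Seq_basic achieves_SetReg
    using lt st mat ans
    by (auto simp: entry_not_workspace column_inv_def pair_inv_def stores_def answers_def
        bilinear_def sesquilinear_def)
qed

lemma pair_step_correct:
  assumes "i < n" "j < i" and inv: "pair_inv n P i j s"
  shows "achieves pair_step (5 * n + 2) (pair_inv n P i (Suc j)) s"
proof (cases s)
  case (Pair r m)
  \<comment> \<open>the state in which the loop over the columns starts\<close>
  define s0 where "s0 = (r(4 := 0), m(n * n := 0, n * n + 1 := 0))"
  have r0: "r 0 = n"
    using inv by (simp add: Pair pair_inv_def stores_def)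
  have init: "column_inv n P i j 0 s0"
    using inv stores_workspace_update[of n P "r(4 := 0)" m 0 0]
      stores_workspace_update[of n P "r(4 := 0)" "m(n * n := 0)" 1 0]
    by (auto simp: s0_def Pair column_inv_def pair_inv_def stores_def answers_def
        bilinear_def sesquilinear_def)
  have loop: "achieves (While (Reg 4) (Reg 0) column_step) (n * 5) (column_inv n P i j n) s0"
  proof (rule achieves_While[where I = "column_inv n P i j"])
    show "achieves column_step 5 (column_inv n P i j (Suc l)) s"
      if "l < n" "column_inv n P i j l s" for l s
      using assms that by (intro column_step_correct) auto
    show "ival (fst s) (Reg 4) < ival (fst s) (Reg 0) \<longleftrightarrow> l < n"
      if "column_inv n P i j l s" for l s
      using that by (simp add: column_inv_def pair_inv_def stores_def)
  qed (fact init)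
  have tests: "achieves
      (Seq (IfZero (workspace 0) Skip (SetReg 5 (Num 0)))
      (Seq (IfZero (workspace 1) Skip (SetReg 6 (Num 0)))
           (SetReg 3 (Plus (Reg 3) (Num 1))))) (Suc (Suc 0))
      (pair_inv n P i (Suc j)) t"
    if t: "column_inv n P i j n t" for t
  proof (cases t)
    case (Pair r m)
    note t' = t[unfolded Pair]
    have "r 0 = n"
      using t' by (simp add: column_inv_def pair_inv_def stores_def)
    then show ?thesis
      unfolding Pair using t' \<open>j < i\<close>
      by (auto simp: achieves_Seq_basic achieves_SetReg column_inv_def pair_inv_def stores_def
          answers_def visited_Suc_pair)
  qed
  have "achieves pair_step (n * 5 + (Suc (Suc 0))) (pair_inv n P i (Suc j)) s"
    using achieves_Seq[OF loop tests] r0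
    by (simp add: pair_step_def Pair achieves_Seq_basic s0_def)
  then show ?thesis by (simp add: mult.commute)
qed

lemma row_step_correct:
  assumes "i < n" and inv: "row_inv n P i s"
  shows "achieves row_step (n * (5 * n + 2)) (row_inv n P (Suc i)) s"
proof (cases s)
  case (Pair r m)
  have loop: "achieves (While (Reg 3) (Reg 2) pair_step) (i * (5 * n + 2))
      (pair_inv n P i i) (r(3 := 0), m)"
  proof (rule achieves_While[where I = "pair_inv n P i"])
    show "achieves pair_step (5 * n + 2) (pair_inv n P i (Suc j)) s"
      if "j < i" "pair_inv n P i j s" for j s
      using assms that by (intro pair_step_correct)
    show "ival (fst s) (Reg 3) < ival (fst s) (Reg 2) \<longleftrightarrow> j < i"
      if "pair_inv n P i j s" for j s
      using that by (simp add: pair_inv_def)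
    show "pair_inv n P i 0 (r(3 := 0), m)"
      using inv by (simp add: Pair row_inv_def pair_inv_def stores_def answers_def)
  qed
  have next_row: "achieves (SetReg 2 (Plus (Reg 2) (Num 1))) 0 (row_inv n P (Suc i)) t"
    if "pair_inv n P i i t" for t
    using that
    by (cases t) (simp add: achieves_SetReg pair_inv_def row_inv_def stores_def answers_def
        visited_Suc_row)
  have "achieves row_step (i * (5 * n + 2) + 0) (row_inv n P (Suc i)) s"
    using achieves_Seq[OF loop next_row] by (simp add: row_step_def Pair achieves_Seq_basic)
  \<comment> \<open>row \<open>i\<close> is paired with \<open>i\<close> rows only, but the rule for the loop over the rows needs a uniform bound\<close>
  moreover have "i * (5 * n + 2) + 0 \<le> n * (5 * n + 2)"
    using \<open>i < n\<close> by (simp only: add_0_right) (intro mult_right_mono, simp_all)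
  ultimately show ?thesis by (rule achieves_weaken)
qed

lemma decide_diagonalization_correct:
  assumes P: "P \<in> carrier_mat n n"
  shows "achieves decide_diagonalization (n * (n * (5 * n + 2)))
     (\<lambda>t. outputs t (orthogonal_diagonalization P) (unitary_diagonalization P))
     (input_state n P)"
proof -
  obtain r m where s: "input_state n P = (r, m)" by (cases "input_state n P")
  have stores: "stores n P (r, m)"
    unfolding s[symmetric] by (auto simp: stores_def input_state_def entry_address_less)
  have loop: "achieves (While (Reg 2) (Reg 0) row_step) (n * (n * (5 * n + 2)))
      (row_inv n P n) (r(5 := 1, 6 := 1, 2 := 0), m)"
  proof (rule achieves_While[where I = "row_inv n P"])
    show "achieves row_step (n * (5 * n + 2)) (row_inv n P (Suc i)) s"
      if "i < n" "row_inv n P i s" for i s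
      using that by (rule row_step_correct)
    show "ival (fst s) (Reg 2) < ival (fst s) (Reg 0) \<longleftrightarrow> i < n"
      if "row_inv n P i s" for i s
      using that by (simp add: row_inv_def stores_def)
    show "row_inv n P 0 (r(5 := 1, 6 := 1, 2 := 0), m)"
      using stores by (simp add: row_inv_def stores_def answers_def visited_0)
  qed
  have all_pairs: "(\<forall>(a, b) \<in> visited n 0. Q a b) \<longleftrightarrow> (\<forall>a<n. \<forall>b<a. Q a b)" for Q
    by (auto simp: visited_def)
  have result: "achieves (Seq (SetReg 0 (Reg 5)) (SetReg 1 (Reg 6))) 0
      (\<lambda>t. outputs t (orthogonal_diagonalization P) (unitary_diagonalization P)) t"
    if "row_inv n P n t" for t
    using that
    by (cases t) (simp add: achieves_Seq_basic achieves_SetReg row_inv_def answers_def outputs_def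
        all_pairs orthogonal_iff_row_pairs[OF P] unitary_iff_row_pairs[OF P])
  show ?thesis
    using achieves_Seq[OF loop result]
    by (simp add: decide_diagonalization_def s achieves_Seq_basic)
qed

theorem proposition4p3:
  "\<exists>(prog :: com) (T :: nat \<Rightarrow> nat).
     (\<lambda>n. real (T n)) \<in> O(\<lambda>n. real n ^ 3) \<and>
     (\<forall>(n :: nat) (d :: nat) (f :: cpoly) (P :: complex mat).
        d \<ge> 3 \<longrightarrow> homogeneous_poly n d f \<longrightarrow> diagonalizable_poly n d f \<longrightarrow>
        diagonalizes n d P f \<longrightarrow>
        (\<exists>k t. exec prog (input_state n P) k t \<and> k \<le> T n \<and>
           outputs t (orthogonal_diagonalization P) (unitary_diagonalization P)))"
proof (rule exI[of _ decide_diagonalization], rule exI[of _ "\<lambda>n. n * (n * (5 * n + 2))"],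
    rule conjI)
  have "n * (n * (5 * n + 2)) \<le> 7 * n ^ 3" for n :: nat
  proof -
    have "5 * n + 2 \<le> 7 * n" if "n > 0" using that by simp
    then have "n * (n * (5 * n + 2)) \<le> n * (n * (7 * n))"
      by (cases "n = 0") (simp, intro mult_left_mono, simp_all)
    then show ?thesis by (simp add: power3_eq_cube mult_ac)
  qed
  then have "real (n * (n * (5 * n + 2))) \<le> 7 * real n ^ 3" for n
    by (metis of_nat_le_iff of_nat_mult of_nat_numeral of_nat_power)
  then show "(\<lambda>n. real (n * (n * (5 * n + 2)))) \<in> O(\<lambda>n. real n ^ 3)"
    by (intro bigoI[where c = 7]) (simp del: of_nat_mult of_nat_add)
next
  have "\<exists>k t. exec decide_diagonalization (input_state n P) k t \<and> k \<le> n * (n * (5 * n + 2)) \<and>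
      outputs t (orthogonal_diagonalization P) (unitary_diagonalization P)"
    if "diagonalizes n d P f" for n d f P
  proof -
    from that have "P \<in> carrier_mat n n" by (simp add: diagonalizes_def)
    from decide_diagonalization_correct[OF this] show ?thesis by (simp only: achieves_def)
  qed
  then show "\<forall>n d f P. 3 \<le> d \<longrightarrow> homogeneous_poly n d f \<longrightarrow> diagonalizable_poly n d f \<longrightarrow>
      diagonalizes n d P f \<longrightarrow>
      (\<exists>k t. exec decide_diagonalization (input_state n P) k t \<and> k \<le> n * (n * (5 * n + 2)) \<and>
         outputs t (orthogonal_diagonalization P) (unitary_diagonalization P))"
    by blast
qed

end
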